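(* Let $n\ge 3$. For any $\mu\in\mathbb{C}$ and any $\mu$-Hurwitz map $\phi$, the induced function $\log^+|\phi|:\mathcal{A}\to\mathbb{R}_{\ge0}$, $\gamma\mapsto\max\{0,\log|\phi(\gamma)|\}$, has an upper Fibonacci bound on $\mathcal{A}$.
   Context: Let $[n]=\{1,\dots,n\}$ and let $\Delta$ be the $n$-regular tree with a distinguished root vertex $v_0$ whose edges are labeled by elements of $[n]$ so that the $n$ edges at each vertex carry distinct labels. For a vertex $v$ and $I\subset[n]$, $[v;I]$ is the connected component containing $v$ of the forest obtained from $\Delta$ by deleting all (open) edges whose label is not in $I$. Write $\hat{i}=[n]\setminus\{i\}$. Let $\mathcal{X}$ be the set of all subtrees $[v;\hat{i}]$ and let $\mathcal{A}$ be the set of all $[v;\{i,j\}]$, $i\ne j$ (alternating geodesics). A Hurwitz map is a function $\phi:\mathcal{X}\to\mathbb{C}$ such that for every edge labeled $i$ with end vertices $v,v'$, $\phi([v;\hat{i}])+\phi([v';\hat{i}])=\prod_{j\ne i}\phi([v;\hat{j}])$. Writing $x_i=\phi([v;\hat{i}])$, the number $\mu=x_1^2+\cdots+x_n^2-x_1\cdots x_n$ is then independent of the vertex $v$, and $\phi$ is called a $\mu$-Hurwitz map. It is extended to $\mathcal{A}$ by $\phi([v;\{i,j\}])=\prod_{k\ne i,j}\phi([v;\hat{k}])$. ($\log^+0=0$.) Fibonacci function $F:\mathcal{A}\to\mathbb{N}$ (relative to $v_0$): $F(\gamma)=1$ if $v_0\in\gamma$; otherwise let $v^*$ be the vertex of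 $\gamma$ closest to $v_0$, write $\gamma=[v^*;\{i,j\}]$, let $k$ be the label of the edge at $v^*$ lying on the geodesic from $v^*$ to $v_0$ (so $k\ne i,j$), and set $F(\gamma)=F([v^*;\{i,k\}])+F([v^*;\{j,k\}])$ (a recursion on the distance from $\gamma$ to $v_0$). A function $f:\mathcal{A}\to\mathbb{R}_{\ge0}$ has an upper Fibonacci bound on $\mathcal{A}$ if there is a constant $K>0$ with $f(\gamma)\le KF(\gamma)$ for all but finitely many $\gamma\in\mathcal{A}$. *)

theory Defs
  imports Complex_Main
begin

section \<open>Edge-labelled regular trees\<close>

text \<open>
  A simple graph on the vertex set \<open>V\<close> is given by its set of edges, each edge being the
  two-element set of its end vertices.  A walk is given by its nonempty list of vertices.
\<close>

definition walk :: "'v set \<Rightarrow> 'v set set \<Rightarrow> 'v list \<Rightarrow> bool" where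
  "walk V F p \<longleftrightarrow> p \<noteq> [] \<and> set p \<subseteq> V \<and> successively (\<lambda>u v. {u, v} \<in> F) p"

definition connected_graph :: "'v set \<Rightarrow> 'v set set \<Rightarrow> bool" where
  "connected_graph V F \<longleftrightarrow> V \<noteq> {} \<and> (\<forall>u\<in>V. \<forall>v\<in>V. \<exists>p. walk V F p \<and> hd p = u \<and> last p = v)"

definition acyclic_graph :: "'v set \<Rightarrow> 'v set set \<Rightarrow> bool" where
  "acyclic_graph V F \<longleftrightarrow>
    \<not> (\<exists>p. walk V F p \<and> distinct p \<and> 3 \<le> length p \<and> {last p, hd p} \<in> F)"

locale labelled_tree =
  fixes n :: nat and V :: "'v set" and E :: "'v set set" and lab :: "'v set \<Rightarrow> nat" and v\<^sub>0 :: 'v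
  assumes simple: "e \<in> E \<Longrightarrow> \<exists>u\<in>V. \<exists>v\<in>V. u \<noteq> v \<and> e = {u, v}"
    and connected: "connected_graph V E"
    and acyclic: "acyclic_graph V E"
    and regular: "v \<in> V \<Longrightarrow> finite {e \<in> E. v \<in> e} \<and> card {e \<in> E. v \<in> e} = n"
    and label: "e \<in> E \<Longrightarrow> lab e \<in> {1..n}"
    and label_inj: "v \<in> V \<Longrightarrow> inj_on lab {e \<in> E. v \<in> e}"
    and root: "v\<^sub>0 \<in> V"
begin

text \<open>
  The subtree \<open>[v;I]\<close> is represented by its vertex set.  Nothing is lost: \<open>\<Delta>\<close> is a tree, so a
  connected subgraph of it is induced by its vertices.
\<close>

definition subtree :: "'v \<Rightarrow> nat set \<Rightarrow> 'v set" where
  "subtree v I = {w. \<exists>p. walk V {e \<in> E. lab e \<in> I} p \<and> hd p = v \<and> last p = w}"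

definition hat :: "nat \<Rightarrow> nat set" where
  "hat i = {1..n} - {i}"

definition \<X> :: "'v set set" where
  "\<X> = {subtree v (hat i) | v i. v \<in> V \<and> i \<in> {1..n}}"

definition \<A> :: "'v set set" where
  "\<A> = {subtree v {i, j} | v i j. v \<in> V \<and> i \<in> {1..n} \<and> j \<in> {1..n} \<and> i \<noteq> j}"


section \<open>Hurwitz maps\<close>

text \<open>
  A map \<open>\<phi> : \<X> \<rightarrow> \<complex>\<close> is a function on all sets of vertices whose values outside
  \<open>\<X>\<close> are irrelevant.
\<close>

definition hurwitz_map :: "('v set \<Rightarrow> complex) \<Rightarrow> bool" where
  "hurwitz_map \<phi> \<longleftrightarrow>
    (\<forall>v v' i. {v, v'} \<in> E \<and> lab {v, v'} = i \<longrightarrow>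
      \<phi> (subtree v (hat i)) + \<phi> (subtree v' (hat i)) = (\<Prod>j\<in>{1..n} - {i}. \<phi> (subtree v (hat j))))"

definition mu_hurwitz_map :: "complex \<Rightarrow> ('v set \<Rightarrow> complex) \<Rightarrow> bool" where
  "mu_hurwitz_map \<mu> \<phi> \<longleftrightarrow> hurwitz_map \<phi> \<and>
    (\<forall>v\<in>V. (\<Sum>i\<in>{1..n}. (\<phi> (subtree v (hat i)))\<^sup>2) - (\<Prod>i\<in>{1..n}. \<phi> (subtree v (hat i))) = \<mu>)"

text \<open>
  The extension of \<open>\<phi>\<close> to \<open>\<A>\<close>; the value does not depend on the presentation
  \<open>\<gamma> = [v;{i,j}]\<close>, see \<open>extension_eq\<close> below.
\<close>

definition extension :: "('v set \<Rightarrow> complex) \<Rightarrow> 'v set \<Rightarrow> complex" where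
  "extension \<phi> \<gamma> = (THE z. \<exists>v i j. v \<in> V \<and> i \<in> {1..n} \<and> j \<in> {1..n} \<and> i \<noteq> j \<and>
      \<gamma> = subtree v {i, j} \<and> z = (\<Prod>k\<in>{1..n} - {i, j}. \<phi> (subtree v (hat k))))"


section \<open>The Fibonacci function\<close>

definition distance :: "'v \<Rightarrow> 'v \<Rightarrow> nat" where
  "distance u v = (LEAST d. \<exists>p. walk V E p \<and> hd p = u \<and> last p = v \<and> length p = Suc d)"

definition geodesic :: "'v list \<Rightarrow> 'v \<Rightarrow> 'v \<Rightarrow> bool" where
  "geodesic p u v \<longleftrightarrow> walk V E p \<and> hd p = u \<and> last p = v \<and> length p = Suc (distance u v)"

definition closest_to_root :: "'v \<Rightarrow> 'v set \<Rightarrow> bool" where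
  "closest_to_root v \<gamma> \<longleftrightarrow> v \<in> \<gamma> \<and> (\<forall>w\<in>\<gamma>. distance v v\<^sub>0 \<le> distance w v\<^sub>0)"

text \<open>
  The recursion for \<open>F\<close>, first as a relation between \<open>\<gamma>\<close> and the value
  \<open>F(\<gamma>)\<close>.  Here \<open>k\<close> is the label of the first edge of the geodesic \<open>p\<close> from
  \<open>v\<close> (the vertex \<open>v\<^sup>*\<close> of \<open>\<gamma>\<close> closest to the root) to the root.
  That this relation is a function on \<open>\<A>\<close> satisfying the recursion is proved in
  \<open>fib_root\<close> and \<open>fib_step\<close> below.
\<close>

inductive fib_value :: "'v set \<Rightarrow> nat \<Rightarrow> bool" where
  fib_value_root: "\<gamma> \<in> \<A> \<Longrightarrow> v\<^sub>0 \<in> \<gamma> \<Longrightarrow> fib_value \<gamma> 1"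
| fib_value_step: "\<gamma> \<in> \<A> \<Longrightarrow> v\<^sub>0 \<notin> \<gamma> \<Longrightarrow> closest_to_root v \<gamma> \<Longrightarrow>
    i \<in> {1..n} \<Longrightarrow> j \<in> {1..n} \<Longrightarrow> i \<noteq> j \<Longrightarrow> \<gamma> = subtree v {i, j} \<Longrightarrow>
    geodesic p v v\<^sub>0 \<Longrightarrow> k = lab {p ! 0, p ! 1} \<Longrightarrow>
    fib_value (subtree v {i, k}) a \<Longrightarrow> fib_value (subtree v {j, k}) b \<Longrightarrow> fib_value \<gamma> (a + b)"

definition fib :: "'v set \<Rightarrow> nat" where
  "fib \<gamma> = (THE m. fib_value \<gamma> m)"

definition upper_fibonacci_bound :: "('v set \<Rightarrow> real) \<Rightarrow> bool" where
  "upper_fibonacci_bound f \<longleftrightarrow> (\<exists>K>0. finite {\<gamma> \<in> \<A>. \<not> f \<gamma> \<le> K * real (fib \<gamma>)})"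

end

definition log_plus :: "real \<Rightarrow> real" where
  "log_plus x = (if x = 0 then 0 else max 0 (ln x))"

section \<open>Well-definedness of the extension and of the Fibonacci function\<close>

lemma walk_nth:
  "walk V F p \<longleftrightarrow> p \<noteq> [] \<and> set p \<subseteq> V \<and> (\<forall>k. Suc k < length p \<longrightarrow> {p ! k, p ! Suc k} \<in> F)"
proof -
  have "successively P p \<longleftrightarrow> (\<forall>k. Suc k < length p \<longrightarrow> P (p ! k) (p ! Suc k))" for P :: "'a \<Rightarrow> 'a \<Rightarrow> bool"
  proof (induction p)
    case (Cons a p)
    show ?case
    proof (cases p)
      case (Cons b q)
      have "(\<forall>k. Suc k < length (a # p) \<longrightarrow> P ((a # p) ! k) ((a # p) ! Suc k)) \<longleftrightarrow>
        P a b \<and> (\<forall>k. Suc k < length p \<longrightarrow> P (p ! k) (p ! Suc k))"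
        using Cons by (auto simp: nth_Cons split: nat.splits)
      then show ?thesis using Cons Cons.IH by simp
    qed simp
  qed simp
  then show ?thesis by (simp add: walk_def)
qed

lemma walk_rev: "walk V F p \<Longrightarrow> walk V F (rev p)"
  by (auto simp: walk_def insert_commute)

lemma walk_join:
  assumes "walk V F p" "walk V F q" "last p = hd q"
  shows "walk V F (p @ tl q)" "hd (p @ tl q) = hd p" "last (p @ tl q) = last q"
proof -
  obtain a q' where q: "q = a # q'" using assms by (cases q) (auto simp: walk_def)
  show "walk V F (p @ tl q)" "hd (p @ tl q) = hd p" "last (p @ tl q) = last q"
    using assms by (auto simp: q walk_def successively_append_iff successively_Cons)
qed

lemma shortest_walk_distinct:
  assumes p: "walk V F p"
    and min: "\<And>q. walk V F q \<Longrightarrow> hd q = hd p \<Longrightarrow> last q = last p \<Longrightarrow> length p \<le> length q"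
  shows "distinct p"
proof (rule ccontr)
  assume "\<not> distinct p"
  then obtain as bs cs x where eq: "p = as @ [x] @ bs @ [x] @ cs"
    using not_distinct_decomp by blast
  have w: "walk V F (as @ [x] @ cs)" 
    using p by (auto simp: eq walk_def successively_append_iff successively_Cons)
  have "length p \<le> length (as @ [x] @ cs)"
    by (rule min[OF w]) (auto simp: eq hd_append)
  then show False by (simp add: eq)
qed

lemma distinct_walk_exists:
  assumes "walk V F p"
  obtains q where "walk V F q" "hd q = hd p" "last q = last p" "distinct q"
proof -
  let ?P = "\<lambda>q. walk V F q \<and> hd q = hd p \<and> last q = last p"
  obtain q where q: "?P q" "\<And>r. ?P r \<Longrightarrow> length q \<le> length r"
    using ex_has_least_nat[of ?P p length] assms by blast
  then have "distinct q" by (intro shortest_walk_distinct[of V F q]) auto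
  with q that show thesis by blast
qed

context labelled_tree
begin

lemma edgeD: "{u, v} \<in> E \<Longrightarrow> u \<noteq> v \<and> u \<in> V \<and> v \<in> V"
  using simple[of "{u, v}"] by (auto simp: doubleton_eq_iff)

lemma nonbacktracking_distinct:
  assumes p: "walk V E p" and nb: "\<And>k. Suc (Suc k) < length p \<Longrightarrow> p ! k \<noteq> p ! Suc (Suc k)"
  shows "distinct p"
proof (rule ccontr)
  assume "\<not> distinct p"
  then obtain i j where ij: "i < j" "j < length p" "p ! i = p ! j"
    unfolding distinct_conv_nth by (metis linorder_neqE_nat)
  let ?P = "\<lambda>d. d > 0 \<and> (\<exists>i. i + d < length p \<and> p ! i = p ! (i + d))"
  have ex: "?P (j - i)" using ij by (auto intro!: exI[of _ i])
  define d where "d = (LEAST d. ?P d)"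
  have d: "?P d" unfolding d_def by (rule LeastI[of ?P, OF ex])
  have least: "\<not> ?P e" if "e < d" for e using not_less_Least[of e ?P] that by (simp add: d_def)
  obtain i where i: "i + d < length p" "p ! i = p ! (i + d)" "d > 0" using d by blast
  have edge: "{p ! k, p ! Suc k} \<in> E" if "Suc k < length p" for k
    using p that by (simp add: walk_nth)
  have "d \<noteq> 1" using edge[of i] edgeD[of "p ! i" "p ! Suc i"] i by auto
  moreover have "d \<noteq> 2" using nb[of i] i by auto
  ultimately have d3: "3 \<le> d" using i by simp
  let ?c = "take d (drop i p)"
  have len: "length ?c = d" using i by simp
  have nth: "?c ! k = p ! (i + k)" if "k < d" for k using that i by simp
  have "distinct ?c" unfolding distinct_conv_nth len
  proof (intro allI impI)
    have *: "?c ! k \<noteq> ?c ! l" if "k < l" "l < d" for k l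
    proof
      assume "?c ! k = ?c ! l"
      then have "p ! (i + k) = p ! ((i + k) + (l - k))" using that nth[of k] nth[of l] by simp
      moreover have "(i + k) + (l - k) < length p" using that i by simp
      ultimately have "?P (l - k)" using that by (intro conjI exI[of _ "i + k"]) auto
      moreover have "l - k < d" using that by linarith
      ultimately show False using least by blast
    qed
    show "?c ! k \<noteq> ?c ! l" if "k < d" "l < d" "k \<noteq> l" for k l
      using *[of k l] *[of l k] that by (metis linorder_neqE_nat)
  qed
  moreover have "walk V E ?c"
    unfolding walk_nth len
  proof (intro conjI allI impI)
    show "?c \<noteq> []" using len d3 by auto
    show "set ?c \<subseteq> V" using p by (meson set_drop_subset set_take_subset subset_trans walk_def)
    show "{?c ! k, ?c ! Suc k} \<in> E" if "Suc k < d" for k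
      using edge[of "i + k"] that i nth[of k] nth[of "Suc k"] by simp
  qed
  moreover have "{last ?c, hd ?c} \<in> E"
  proof -
    have ne: "?c \<noteq> []" using len d3 by auto
    have "last ?c = p ! (i + (d - 1))" using ne nth[of "d - 1"] d3 len by (simp add: last_conv_nth)
    moreover have "hd ?c = p ! Suc (i + (d - 1))" using ne nth[of 0] d3 i by (simp add: hd_conv_nth)
    ultimately show ?thesis using edge[of "i + (d - 1)"] d3 i by simp
  qed
  ultimately show False using acyclic d3 len unfolding acyclic_graph_def by metis
qed

lemma join_distinct:
  assumes p: "walk V E p" "distinct p" "2 \<le> length p"
    and q: "walk V E q" "distinct q" "2 \<le> length q"
    and pq: "last p = hd q" "p ! (length p - 2) \<noteq> q ! 1"
  shows "distinct (p @ tl q)"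
proof (rule nonbacktracking_distinct)
  show "walk V E (p @ tl q)" using walk_join p q pq by blast
  have A: "(p @ tl q) ! k = p ! k" if "k < length p" for k using that by (simp add: nth_append)
  have B: "(p @ tl q) ! k = q ! (k - (length p - 1))" if "length p - 1 \<le> k" "k < length (p @ tl q)" for k
  proof (cases "k < length p")
    case True
    then have "k = length p - 1" using that by simp
    then have "(p @ tl q) ! k = last p" using True by (metis A last_conv_nth length_0_conv not_less_zero)
    also have "\<dots> = q ! 0" using pq q by (metis hd_conv_nth walk_def)
    finally show ?thesis using \<open>k = length p - 1\<close> by simp
  next
    case False
    then have "(p @ tl q) ! k = q ! Suc (k - length p)"
      using that by (simp add: nth_append nth_tl)
    moreover have "Suc (k - length p) = k - (length p - 1)" using False p by simp
    ultimately show ?thesis by simp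
  qed
  fix k assume k: "Suc (Suc k) < length (p @ tl q)"
  consider "Suc (Suc k) < length p" | "Suc (Suc k) = length p" | "length p \<le> Suc k" by linarith
  then show "(p @ tl q) ! k \<noteq> (p @ tl q) ! Suc (Suc k)"
  proof cases
    case 1
    then show ?thesis using A[of k] A[of "Suc (Suc k)"] p by (simp add: nth_eq_iff_index_eq)
  next
    case 2
    then have "k = length p - 2" by simp
    moreover have "(p @ tl q) ! Suc (Suc k) = q ! 1" using B[of "Suc (Suc k)"] 2 k by simp
    ultimately show ?thesis using A[of k] 2 pq by simp
  next
    case 3
    have "(p @ tl q) ! k = q ! (k - (length p - 1))" using B[of k] 3 k by simp
    moreover have "(p @ tl q) ! Suc (Suc k) = q ! (Suc (Suc k) - (length p - 1))"
      using B[of "Suc (Suc k)"] 3 k by simp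
    ultimately show ?thesis using k 3 p q by (simp add: nth_eq_iff_index_eq)
  qed
qed

lemma subtree_subset: "subtree v I \<subseteq> V"
  by (auto simp: subtree_def walk_def)

lemma subtree_refl: "v \<in> V \<Longrightarrow> v \<in> subtree v I"
  by (auto simp: subtree_def walk_def intro!: exI[of _ "[v]"])

lemma subtree_sym: "w \<in> subtree v I \<Longrightarrow> v \<in> subtree w I"
proof -
  assume "w \<in> subtree v I"
  then obtain p where p: "walk V {e \<in> E. lab e \<in> I} p" "hd p = v" "last p = w"
    by (auto simp: subtree_def)
  have "walk V {e \<in> E. lab e \<in> I} (rev p)" by (rule walk_rev[OF p(1)])
  moreover have "hd (rev p) = w" "last (rev p) = v" using p by (auto simp: hd_rev last_rev)
  ultimately show ?thesis unfolding subtree_def by blast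
qed

lemma subtree_trans: "w \<in> subtree v I \<Longrightarrow> x \<in> subtree w I \<Longrightarrow> x \<in> subtree v I"
proof -
  assume "w \<in> subtree v I" "x \<in> subtree w I"
  then obtain p q where p: "walk V {e \<in> E. lab e \<in> I} p" "hd p = v" "last p = w"
    and q: "walk V {e \<in> E. lab e \<in> I} q" "hd q = w" "last q = x"
    by (auto simp: subtree_def)
  then show ?thesis using walk_join[OF p(1) q(1)] unfolding subtree_def by auto
qed

lemma subtree_eq: "w \<in> subtree v I \<Longrightarrow> subtree w I = subtree v I"
  using subtree_sym subtree_trans by blast

lemma subtree_mono: "I \<subseteq> J \<Longrightarrow> subtree v I \<subseteq> subtree v J"
proof -
  assume IJ: "I \<subseteq> J"
  have "walk V {e \<in> E. lab e \<in> J} p" if "walk V {e \<in> E. lab e \<in> I} p" for p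
    using that IJ by (auto simp: walk_nth)
  then show ?thesis by (auto simp: subtree_def)
qed

lemma edge_in_subtree: "{u, v} \<in> E \<Longrightarrow> lab {u, v} \<in> I \<Longrightarrow> v \<in> subtree u I"
  using edgeD by (auto simp: subtree_def walk_def intro!: exI[of _ "[u, v]"])

lemma edge_exists:
  assumes "v \<in> V" "i \<in> {1..n}"
  obtains w where "{v, w} \<in> E" "lab {v, w} = i"
proof -
  have "card (lab ` {e \<in> E. v \<in> e}) = n" using regular label_inj assms by (simp add: card_image)
  moreover have "lab ` {e \<in> E. v \<in> e} \<subseteq> {1..n}" using label by blast
  ultimately have "lab ` {e \<in> E. v \<in> e} = {1..n}" by (intro card_subset_eq) auto
  then have "i \<in> lab ` {e \<in> E. v \<in> e}" using assms(2) by (simp only:)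
  then obtain e where e: "e \<in> E" "v \<in> e" "lab e = i" by blast
  then obtain a b where "e = {a, b}" using simple by blast
  then obtain w where "e = {v, w}" using e(2) by (metis insertE insert_commute singletonD)
  then show thesis using e that by blast
qed

lemma subtreeE:
  assumes "w \<in> subtree v I"
  obtains p where "walk V {e \<in> E. lab e \<in> I} p" "hd p = v" "last p = w" "distinct p"
proof -
  obtain p where p: "walk V {e \<in> E. lab e \<in> I} p" "hd p = v" "last p = w"
    using assms by (auto simp: subtree_def)
  show thesis by (rule distinct_walk_exists[OF p(1)]) (use p that in auto)
qed

lemma subtree_label_subset:
  assumes "v \<in> V" "I \<subseteq> {1..n}" "subtree v I \<subseteq> subtree v J"
  shows "I \<subseteq> J"
proof
  fix i assume i: "i \<in> I"
  obtain w where w: "{v, w} \<in> E" "lab {v, w} = i" using edge_exists assms i by blast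
  then have "w \<in> subtree v J" using edge_in_subtree assms i by blast
  then obtain p where p: "walk V {e \<in> E. lab e \<in> J} p" "hd p = v" "last p = w" "distinct p"
    by (rule subtreeE)
  have E: "walk V E p" using p by (auto simp: walk_nth)
  have "\<not> 3 \<le> length p" using acyclic E p w unfolding acyclic_graph_def
    by (metis insert_commute)
  moreover have "v \<noteq> w" using edgeD w by blast
  ultimately have "p = [v, w]" using p
    by (cases p; cases "tl p"; cases "tl (tl p)") (auto simp: walk_def)
  then show "i \<in> J" using p w by (auto simp: walk_def)
qed

lemma subtree_labels_unique:
  assumes "v \<in> V" "w \<in> V" "I \<subseteq> {1..n}" "J \<subseteq> {1..n}" "subtree v I = subtree w J"
  shows "I = J"
proof -
  have "v \<in> subtree w J" using subtree_refl[OF assms(1), of I] unfolding assms(5) .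
  then have "subtree v I = subtree v J" unfolding assms(5) by (rule subtree_eq[symmetric])
  then show ?thesis using subtree_label_subset[OF assms(1,3), of J] subtree_label_subset[OF assms(1,4), of I]
    by (simp only: subset_refl subset_antisym)
qed

lemma extension_eq:
  assumes "v \<in> V" "i \<in> {1..n}" "j \<in> {1..n}" "i \<noteq> j"
  shows "extension \<phi> (subtree v {i, j}) = (\<Prod>k\<in>{1..n} - {i, j}. \<phi> (subtree v (hat k)))"
  unfolding extension_def
proof (rule the_equality)
  fix z assume "\<exists>v' i' j'. v' \<in> V \<and> i' \<in> {1..n} \<and> j' \<in> {1..n} \<and> i' \<noteq> j' \<and>
      subtree v {i, j} = subtree v' {i', j'} \<and> z = (\<Prod>k\<in>{1..n} - {i', j'}. \<phi> (subtree v' (hat k)))"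
  then obtain v' i' j' where *: "v' \<in> V" "i' \<in> {1..n}" "j' \<in> {1..n}"
      "subtree v {i, j} = subtree v' {i', j'}" "z = (\<Prod>k\<in>{1..n} - {i', j'}. \<phi> (subtree v' (hat k)))"
    by blast
  have ij: "{i, j} = {i', j'}" using subtree_labels_unique[of v v'] assms * by auto
  have "v' \<in> subtree v {i, j}" using * subtree_refl by simp
  have sub: "subtree v' (hat k) = subtree v (hat k)" if k: "k \<in> {1..n} - {i, j}" for k
  proof -
    have "{i, j} \<subseteq> hat k" using k assms by (auto simp: hat_def)
    then show ?thesis using \<open>v' \<in> subtree v {i, j}\<close> by (rule subtree_eq[OF subsetD[OF subtree_mono]])
  qed
  show "z = (\<Prod>k\<in>{1..n} - {i, j}. \<phi> (subtree v (hat k)))"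
    unfolding *(5) ij[symmetric] by (rule prod.cong[OF refl]) (simp only: sub)
qed (use assms in blast)

lemma geodesic_exists:
  assumes "u \<in> V" "v \<in> V"
  obtains p where "geodesic p u v"
proof -
  let ?P = "\<lambda>d. \<exists>p. walk V E p \<and> hd p = u \<and> last p = v \<and> length p = Suc d"
  obtain p where p: "walk V E p" "hd p = u" "last p = v"
    using connected assms unfolding connected_graph_def by blast
  then have "?P (length p - 1)" by (auto simp: walk_def intro!: exI[of _ p])
  then have "?P (distance u v)" unfolding distance_def by (rule LeastI)
  then show thesis using that by (auto simp: geodesic_def)
qed

lemma distance_le:
  assumes "walk V E p" "hd p = u" "last p = v"
  shows "Suc (distance u v) \<le> length p"
proof -
  have "distance u v \<le> length p - 1" unfolding distance_def
    by (rule Least_le) (use assms in \<open>auto simp: walk_def intro!: exI[of _ p]\<close>)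
  then show ?thesis using assms by (cases p) (auto simp: walk_def)
qed

lemma geodesic_distinct: "geodesic p u v \<Longrightarrow> distinct p"
  by (rule shortest_walk_distinct[of V E]) (auto simp: geodesic_def distance_le)

lemma geodesic_step:
  assumes "geodesic p u v" "u \<noteq> v"
  shows "2 \<le> length p" "p ! 0 = u" "{u, p ! 1} \<in> E" "distance (p ! 1) v < distance u v"
proof -
  have w: "walk V E p" "hd p = u" "last p = v" using assms by (auto simp: geodesic_def)
  obtain a where "p = u # tl p" "tl p \<noteq> []" using w assms(2)
    by (metis hd_Cons_tl last.simps walk_def)
  then obtain b q where p: "p = u # b # q" by (metis list.exhaust)
  show "2 \<le> length p" "p ! 0 = u" "{u, p ! 1} \<in> E" using w p by (auto simp: walk_def)
  have "Suc (distance b v) \<le> length (b # q)"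
    by (rule distance_le) (use w p in \<open>auto simp: walk_def\<close>)
  then show "distance (p ! 1) v < distance u v" using assms p by (simp add: geodesic_def)
qed

lemma geodesic_first_edge_unique:
  assumes "geodesic p u v" "geodesic q u v" "u \<noteq> v"
  shows "p ! 1 = q ! 1"
proof (rule ccontr)
  assume ne: "p ! 1 \<noteq> q ! 1"
  note p = geodesic_step[OF assms(1,3)] and q = geodesic_step[OF assms(2,3)]
  have w: "walk V E p" "hd p = u" "last p = v" "walk V E q" "hd q = u" "last q = v"
    using assms by (auto simp: geodesic_def)
  have "distinct (rev p @ tl q)"
  proof (rule join_distinct)
    show "walk V E (rev p)" by (rule walk_rev[OF w(1)])
    show "last (rev p) = hd q" using w by (simp add: last_rev)
    show "rev p ! (length (rev p) - 2) \<noteq> q ! 1" using ne p(1) 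
      by (simp add: rev_nth numeral_2_eq_2 Suc_diff_Suc)
  qed (use w p q assms geodesic_distinct in auto)
  moreover have "v \<in> set p" "v \<in> set (tl q)"
    using w p q by (metis last_in_set list.size(3) not_numeral_le_zero)
      (metis w q(1) assms(3) hd_Cons_tl last_ConsL last_ConsR last_in_set walk_def)
  ultimately show False by auto
qed

lemma closest_unique:
  assumes g: "\<gamma> = subtree x I" and x: "v\<^sub>0 \<notin> \<gamma>" and u: "closest_to_root u \<gamma>" and v: "closest_to_root v \<gamma>"
  shows "u = v"
proof (rule ccontr)
  assume ne: "u \<noteq> v"
  have mem: "u \<in> \<gamma>" "v \<in> \<gamma>" using u v by (auto simp: closest_to_root_def)
  have V: "u \<in> V" "v \<in> V" "u \<noteq> v\<^sub>0" "v \<noteq> v\<^sub>0" using mem x g subtree_subset by auto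
  obtain p where p: "geodesic p u v\<^sub>0" using geodesic_exists V root by blast
  obtain q where q: "geodesic q v v\<^sub>0" using geodesic_exists V root by blast
  note P = geodesic_step[OF p V(3)] and Q = geodesic_step[OF q V(4)]
  have W: "walk V E p" "hd p = u" "last p = v\<^sub>0" "distinct p" "walk V E q" "hd q = v" "last q = v\<^sub>0" "distinct q"
    using p q geodesic_distinct by (auto simp: geodesic_def)
  have out: "p ! 1 \<notin> \<gamma>" "q ! 1 \<notin> \<gamma>" using P(4) Q(4) u v unfolding closest_to_root_def by (meson not_less)+
  have "\<gamma> = subtree u I" using subtree_eq[OF mem(1)[unfolded g]] g by (simp only:)
  then have "v \<in> subtree u I" using mem by simp
  then obtain r where r: "walk V {e \<in> E. lab e \<in> I} r" "hd r = u" "last r = v" "distinct r"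
    by (rule subtreeE)
  have rE: "walk V E r" using r by (auto simp: walk_nth)
  have r2: "2 \<le> length r"
    using r ne by (cases r; cases "tl r") (auto simp: walk_def)
  have rin: "set r \<subseteq> \<gamma>"
  proof
    fix y assume "y \<in> set r"
    then obtain as bs where s: "r = as @ y # bs" by (auto simp: in_set_conv_decomp)
    have "walk V {e \<in> E. lab e \<in> I} (as @ [y])" "hd (as @ [y]) = u" "last (as @ [y]) = y"
      using r s by (auto simp: walk_def successively_append_iff hd_append)
    then show "y \<in> \<gamma>" unfolding \<open>\<gamma> = subtree u I\<close> subtree_def by blast
  qed
  have r1: "r ! 1 \<in> \<gamma>" "r ! (length r - 2) \<in> \<gamma>" using rin r2 by (auto intro!: nth_mem subsetD[OF rin])
  have d1: "distinct (rev p @ tl r)"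
  proof (rule join_distinct)
    show "walk V E (rev p)" by (rule walk_rev[OF W(1)])
    show "last (rev p) = hd r" using W r by (simp add: last_rev)
    have "rev p ! (length (rev p) - 2) = p ! 1" using P(1)
      by (simp add: rev_nth numeral_2_eq_2 Suc_diff_Suc)
    then show "rev p ! (length (rev p) - 2) \<noteq> r ! 1" using out r1 by auto
  qed (use W P rE r r2 in auto)
  have W1: "walk V E (rev p @ tl r)" "last (rev p @ tl r) = v" 
    using walk_join[OF walk_rev[OF W(1)] rE] W r by (auto simp: last_rev)
  have d2: "distinct ((rev p @ tl r) @ tl q)"
  proof (rule join_distinct)
    have "(rev p @ tl r) ! (length (rev p @ tl r) - 2) = r ! (length r - 2)"
    proof (cases "length r = 2")
      case True
      then have "length (rev p @ tl r) - 2 = length p - 1" "length p - 1 < length (rev p)"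
        using P(1) by auto
      then have "(rev p @ tl r) ! (length (rev p @ tl r) - 2) = rev p ! (length p - 1)"
        by (simp only: nth_append if_True)
      also have "\<dots> = u" using P(1,2) by (simp add: rev_nth)
      also have "\<dots> = r ! 0" using r by (metis hd_conv_nth walk_def)
      finally show ?thesis using True by simp
    next
      case False
      then have l: "length (rev p @ tl r) - 2 = length p + (length r - 3)" using r2 by simp
      have "(rev p @ tl r) ! (length (rev p @ tl r) - 2) = tl r ! (length r - 3)"
        unfolding l by (simp add: nth_append)
      also have "\<dots> = r ! Suc (length r - 3)" using False r2 by (simp add: nth_tl)
      also have "Suc (length r - 3) = length r - 2" using False r2 by simp
      finally show ?thesis .
    qed
    then show "(rev p @ tl r) ! (length (rev p @ tl r) - 2) \<noteq> q ! 1" using out r1 by auto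
  qed (use W W1 d1 P Q in auto)
  have "v\<^sub>0 \<in> set p" "v\<^sub>0 \<in> set (tl q)"
    using W P(1) by (metis last_in_set list.size(3) not_numeral_le_zero)
      (metis W(5,6,7) V(4) hd_Cons_tl last_ConsL last_ConsR last_in_set walk_def)
  then show False using d2 by auto
qed

lemma fib_value_fun:
  assumes "fib_value \<gamma> a" "fib_value \<gamma> b"
  shows "a = b"
  using assms
proof (induction arbitrary: b rule: fib_value.induct)
  case (fib_value_root \<gamma>)
  from fib_value_root.prems show ?case
  proof (cases rule: fib_value.cases)
    case (fib_value_step v i j p k b1 b2)
    then show ?thesis using fib_value_root.hyps(2) by blast
  qed (rule sym)
next
  case (fib_value_step \<gamma> v i j p k a1 a2)
  note h = fib_value_step.hyps and IH = fib_value_step.IH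
  from fib_value_step.prems show ?case
  proof (cases rule: fib_value.cases)
    case fib_value_root
    then show ?thesis using h(2) by blast
  next
    case (fib_value_step v' i' j' p' k' b1 b2)
    note s = fib_value_step
    have v: "v' = v" using closest_unique[OF h(7,2) s(4) h(3)] .
    have "v \<in> \<gamma>" using h(3) by (simp add: closest_to_root_def)
    then have vV: "v \<in> V" "v \<noteq> v\<^sub>0" using h(2) subtree_subset unfolding h(7) by blast+
    have "subtree v {i, j} = subtree v {i', j'}" using h(7) s(8) unfolding v by (rule subst)
    then have ij: "{i, j} = {i', j'}"
      by (rule subtree_labels_unique[rotated -1]) (use vV h(4,5) s(5,6) in auto)
    have p': "geodesic p' v v\<^sub>0" using s(9) unfolding v .
    have k: "k' = k"
      unfolding h(9) s(10) geodesic_first_edge_unique[OF h(8) p' vV(2)]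
        geodesic_step(2)[OF h(8) vV(2)] geodesic_step(2)[OF p' vV(2)] ..
    consider "i' = i" "j' = j" | "i' = j" "j' = i" using ij by (auto simp: doubleton_eq_iff)
    then show ?thesis
    proof cases
      case 1
      have "a1 = b1" "a2 = b2" by (rule IH, use s(11,12) 1 v k in simp)+
      then show ?thesis using s(1) by simp
    next
      case 2
      have "a1 = b2" "a2 = b1" by (rule IH, use s(11,12) 2 v k in simp)+
      then show ?thesis using s(1) by simp
    qed
  qed
qed

lemma AI: "v \<in> V \<Longrightarrow> i \<in> {1..n} \<Longrightarrow> j \<in> {1..n} \<Longrightarrow> i \<noteq> j \<Longrightarrow> subtree v {i, j} \<in> \<A>"
  unfolding \<A>_def by blast

lemma root_label:
  assumes v: "closest_to_root v (subtree v I)" "v\<^sub>0 \<notin> subtree v I" and p: "geodesic p v v\<^sub>0"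
  shows "lab {p ! 0, p ! 1} \<in> {1..n}" "lab {p ! 0, p ! 1} \<notin> I"
proof -
  have "v \<in> subtree v I" using v(1) by (simp add: closest_to_root_def)
  then have ne: "v \<noteq> v\<^sub>0" using v(2) by blast
  note P = geodesic_step[OF p ne]
  show "lab {p ! 0, p ! 1} \<in> {1..n}" using label P by simp
  have "p ! 1 \<notin> subtree v I" using P(4) v(1) unfolding closest_to_root_def by (meson not_less)
  then show "lab {p ! 0, p ! 1} \<notin> I" using edge_in_subtree[OF P(3)] P(2) by auto
qed

lemma fib_value_exists:
  assumes "v \<in> V" "i \<in> {1..n}" "j \<in> {1..n}" "i \<noteq> j"
  shows "\<exists>m. fib_value (subtree v {i, j}) m"
  using assms
proof (induction "distance v v\<^sub>0" arbitrary: v i j rule: less_induct)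
  case less
  let ?g = "subtree v {i, j}"
  have A: "?g \<in> \<A>" using AI less.prems by blast
  show ?case
  proof (cases "v\<^sub>0 \<in> ?g")
    case True
    then show ?thesis using A fib_value_root by blast
  next
    case False
    obtain u where u: "u \<in> ?g" "\<And>w. w \<in> ?g \<Longrightarrow> distance u v\<^sub>0 \<le> distance w v\<^sub>0"
      using ex_has_least_nat[of "\<lambda>u. u \<in> ?g" v "\<lambda>u. distance u v\<^sub>0"] subtree_refl[OF less.prems(1)] by blast
    have gu: "?g = subtree u {i, j}" using subtree_eq[OF u(1)] by (rule sym)
    have c: "closest_to_root u ?g" using u by (simp add: closest_to_root_def)
    have uV: "u \<in> V" using u(1) subtree_subset by blast
    have ne: "u \<noteq> v\<^sub>0" using u False by blast
    obtain p where p: "geodesic p u v\<^sub>0" using geodesic_exists[OF uV root] .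
    define k where "k = lab {p ! 0, p ! 1}"
    note P = geodesic_step[OF p ne]
    have k: "k \<in> {1..n}" "k \<notin> {i, j}"
      using root_label[of u "{i, j}" p] c False p gu by (simp_all add: k_def)
    have V: "p ! 1 \<in> V" using edgeD[OF P(3)] by blast
    have d: "distance (p ! 1) v\<^sub>0 < distance v v\<^sub>0"
      using P(4) u(2)[OF subtree_refl[OF less.prems(1)]] by simp
    have "\<exists>m. fib_value (subtree u {l, k}) m" if l: "l \<in> {i, j}" for l
    proof -
      have "p ! 1 \<in> subtree u {l, k}" by (rule edge_in_subtree[OF P(3)]) (use P(2) k_def in simp)
      then have "subtree (p ! 1) {l, k} = subtree u {l, k}" by (rule subtree_eq)
      moreover have "\<exists>m. fib_value (subtree (p ! 1) {l, k}) m"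
        by (rule less.hyps[OF d V]) (use l k less.prems in auto)
      ultimately show ?thesis by simp
    qed
    then obtain a b where "fib_value (subtree u {i, k}) a" "fib_value (subtree u {j, k}) b" by blast
    from fib_value_step[OF A False c less.prems(2-4) gu p k_def this] show ?thesis by blast
  qed
qed

lemma fib_eqI: "fib_value \<gamma> m \<Longrightarrow> fib \<gamma> = m"
  unfolding fib_def by (rule the_equality) (auto intro: fib_value_fun)

lemma fib_root: "\<gamma> \<in> \<A> \<Longrightarrow> v\<^sub>0 \<in> \<gamma> \<Longrightarrow> fib \<gamma> = 1"
  by (intro fib_eqI fib_value_root)

lemma fib_step:
  assumes "v \<in> V" "i \<in> {1..n}" "j \<in> {1..n}" "i \<noteq> j" "\<gamma> = subtree v {i, j}"
    and "v\<^sub>0 \<notin> \<gamma>" "closest_to_root v \<gamma>" "geodesic p v v\<^sub>0" "k = lab {p ! 0, p ! 1}"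
  shows "fib \<gamma> = fib (subtree v {i, k}) + fib (subtree v {j, k})"
proof -
  have A: "\<gamma> \<in> \<A>" using AI assms by blast
  have k: "k \<in> {1..n}" "k \<notin> {i, j}" using root_label[of v "{i, j}" p] assms by simp_all
  obtain a where a: "fib_value (subtree v {i, k}) a"
    using fib_value_exists[of v i k] assms(1,2) k by blast
  obtain b where b: "fib_value (subtree v {j, k}) b"
    using fib_value_exists[of v j k] assms(1,3) k by blast
  show ?thesis
    using fib_eqI[OF fib_value_step[OF A assms(6,7,2-5,8,9) a b]] fib_eqI[OF a] fib_eqI[OF b] by simp
qed

end

end

(*
  Replace each coordinate x by its truncation max 1 |x|.  At every vertex each coordinate z is a root
  of the quadratic t^2 - p t + S - \<mu>, where p is the product and S the sum of squares of the other
  coordinates.  Hence its truncation is at most a constant times the product of the truncations of the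
  other coordinates.  For the edge k pointing to the root this says that the truncated extension e
  satisfies e[v;{i,j}] \<le> C e[v;{i,k}] e[v;{j,k}], so C e is submultiplicative along the Fibonacci
  recursion.  Without the truncation this fails for n > 3, since x_i and x_j may vanish.
*)
theory Submission
  imports Defs
begin

text \<open>Truncation makes \<open>Q\<close> dominate each of the other coordinates as well as
  their product, so one quantity controls both coefficients of the quadratic: \<open>p\<close> by
  \<open>Q\<close> and \<open>S\<close> by a multiple of its square.\<close>

lemma truncated_quadratic_root_bound:
  fixes f :: "'a \<Rightarrow> complex" and \<mu> :: complex
  assumes A: "finite A" and k: "k \<in> A"
    and eq: "(\<Sum>l\<in>A. (f l)\<^sup>2) - (\<Prod>l\<in>A. f l) = \<mu>"
  shows "max 1 (cmod (f k)) \<le> (card A + 1 + cmod \<mu>) * (\<Prod>l\<in>A - {k}. max 1 (cmod (f l)))"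
proof -
  define Q where "Q = (\<Prod>l\<in>A - {k}. max 1 (cmod (f l)))"
  define z where "z = cmod (f k)"
  define S where "S = (\<Sum>l\<in>A - {k}. (f l)\<^sup>2) - \<mu>"
  define p where "p = (\<Prod>l\<in>A - {k}. f l)"
  define D where "D = card A + cmod \<mu>"
  have Q1: "1 \<le> Q" unfolding Q_def by (rule prod_ge_1) simp
  have le: "cmod (f l) \<le> Q" if "l \<in> A - {k}" for l
  proof -
    have "(\<Prod>l\<in>{l}. max 1 (cmod (f l))) \<le> Q"
      unfolding Q_def by (rule prod_mono2) (use A that in auto)
    then show ?thesis by simp
  qed
  have p: "cmod p \<le> Q"
    unfolding p_def Q_def prod_norm[symmetric] by (rule prod_mono) simp
  have "cmod S \<le> (\<Sum>l\<in>A - {k}. cmod ((f l)\<^sup>2)) + cmod \<mu>"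
    unfolding S_def by (rule order_trans[OF norm_triangle_ineq4]) (simp add: norm_sum)
  also have "(\<Sum>l\<in>A - {k}. cmod ((f l)\<^sup>2)) \<le> (\<Sum>l\<in>A - {k}. Q\<^sup>2)"
    using le by (intro sum_mono) (simp add: norm_power power_mono)
  also have "\<dots> \<le> card A * Q\<^sup>2"
    using A by (simp add: mult_right_mono card_mono)
  also have "cmod \<mu> \<le> cmod \<mu> * Q\<^sup>2" using Q1 by (simp add: mult_le_cancel_left1)
  finally have S: "cmod S \<le> D * Q\<^sup>2" by (simp add: D_def algebra_simps)
  have "(f k)\<^sup>2 = f k * p - S"
    using eq A k by (simp add: S_def p_def sum.remove[of A k] prod.remove[of A k] algebra_simps)
  then have "z\<^sup>2 = cmod (f k * p - S)" unfolding z_def by (metis norm_power)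
  also have "\<dots> \<le> cmod (f k * p) + cmod S" by (rule norm_triangle_ineq4)
  also have "\<dots> \<le> z * Q + D * Q\<^sup>2"
    using p S by (simp add: norm_mult z_def add_mono mult_left_mono)
  finally have z2: "z\<^sup>2 \<le> z * Q + D * Q\<^sup>2" .
  have D0: "0 \<le> D" by (simp add: D_def)
  have zD: "z \<le> (D + 1) * Q"
  proof (cases "z \<le> Q")
    case True
    have "1 * Q \<le> (D + 1) * Q" using D0 Q1 by (intro mult_right_mono) auto
    with True show ?thesis by simp
  next
    \<comment> \<open>Here \<open>z\<close> exceeds \<open>Q\<close>, so one factor \<open>Q\<close>
      of the last term may be replaced by \<open>z\<close>, and \<open>z\<close> then
      cancels.\<close>
    case False
    then have "D * Q * Q \<le> D * Q * z" using D0 Q1 by (intro mult_left_mono) auto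
    then have "z * z \<le> ((D + 1) * Q) * z" using z2 by (simp add: power2_eq_square algebra_simps)
    then show ?thesis using False Q1 by (simp add: mult_le_cancel_right)
  qed
  have "1 * 1 \<le> (D + 1) * Q" using D0 Q1 by (intro mult_mono) auto
  then show ?thesis using zD unfolding Q_def z_def D_def by (simp add: add_ac)
qed

lemma log_plus_le:
  assumes "0 \<le> x" "x \<le> y" "1 \<le> y"
  shows "log_plus x \<le> ln y"
  using assms by (simp add: log_plus_def)

context labelled_tree
begin

text \<open>Complex-valued so that \<open>extension\<close> applies to it:
  \<open>extension_eq\<close> holds for arbitrary maps, Hurwitz or not.\<close>

definition trunc :: "('v set \<Rightarrow> complex) \<Rightarrow> 'v set \<Rightarrow> complex" where
  "trunc \<phi> X = complex_of_real (max 1 (cmod (\<phi> X)))"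

lemma norm_extension_trunc:
  assumes "v \<in> V" "i \<in> {1..n}" "j \<in> {1..n}" "i \<noteq> j"
  shows "cmod (extension (trunc \<phi>) (subtree v {i, j}))
    = (\<Prod>l\<in>{1..n} - {i, j}. max 1 (cmod (\<phi> (subtree v (hat l)))))"
  unfolding extension_eq[OF assms] prod_norm[symmetric] trunc_def
  by (simp only: norm_of_real abs_of_nonneg[OF order_trans[OF zero_le_one max.cobounded1]])

lemma norm_extension_le_trunc:
  assumes "\<gamma> \<in> \<A>"
  shows "cmod (extension \<phi> \<gamma>) \<le> cmod (extension (trunc \<phi>) \<gamma>)"
proof -
  obtain v i j where g: "v \<in> V" "i \<in> {1..n}" "j \<in> {1..n}" "i \<noteq> j" "\<gamma> = subtree v {i, j}"
    using assms unfolding \<A>_def by blast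
  show ?thesis unfolding g(5) norm_extension_trunc[OF g(1-4)] extension_eq[OF g(1-4)] prod_norm[symmetric]
    by (rule prod_mono) (simp add: trunc_def)
qed

text \<open>Sums in the recursion for \<open>fib_value\<close> become products of powers of
  \<open>B\<close>. The base \<open>B\<close> is chosen to bound every geodesic through the root at
  once.\<close>

lemma fib_value_bound:
  assumes \<phi>: "mu_hurwitz_map \<mu> \<phi>" and "fib_value \<gamma> m"
  defines "C \<equiv> real n + 1 + cmod \<mu>"
  defines "B \<equiv> C * (\<Prod>l\<in>{1..n}. max 1 (cmod (\<phi> (subtree v\<^sub>0 (hat l)))))"
  shows "C * cmod (extension (trunc \<phi>) \<gamma>) \<le> B ^ m"
  using assms(2)
proof (induction rule: fib_value.induct)
  case (fib_value_root \<gamma>)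
  obtain v i j where g: "v \<in> V" "i \<in> {1..n}" "j \<in> {1..n}" "i \<noteq> j" "\<gamma> = subtree v {i, j}"
    using fib_value_root(1) unfolding \<A>_def by blast
  \<comment> \<open>Rebasing at the root turns the extension into a subproduct of the product in
    \<open>B\<close>; the missing factors are at least 1.\<close>
  have "\<gamma> = subtree v\<^sub>0 {i, j}" using subtree_eq fib_value_root(2) unfolding g(5) by blast
  then have "cmod (extension (trunc \<phi>) \<gamma>)
      = (\<Prod>l\<in>{1..n} - {i, j}. max 1 (cmod (\<phi> (subtree v\<^sub>0 (hat l)))))"
    using norm_extension_trunc[OF root g(2-4)] by simp
  also have "\<dots> \<le> (\<Prod>l\<in>{1..n}. max 1 (cmod (\<phi> (subtree v\<^sub>0 (hat l)))))"
    by (rule prod_mono2) auto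
  finally show ?case unfolding B_def power_one_right by (rule mult_left_mono) (simp add: C_def)
next
  case (fib_value_step \<gamma> v i j p k a b)
  note h = fib_value_step.hyps and IH = fib_value_step.IH
  have v: "v \<in> V" using h(3,7) subtree_subset unfolding closest_to_root_def by blast
  have k: "k \<in> {1..n}" "k \<notin> {i, j}"
    using root_label[of v "{i, j}" p] h by simp_all
  \<comment> \<open>The three geodesics of the recursion all pass through \<open>v\<close>. Each
    truncated extension is the common factor \<open>P\<close> times the coordinate of the one label
    among i, j, k that the geodesic omits.\<close>
  define x where "x l = max 1 (cmod (\<phi> (subtree v (hat l))))" for l
  define P where "P = prod x ({1..n} - {i, j, k})"
  have P0: "0 \<le> P" unfolding P_def x_def by (rule prod_nonneg) simp
  have C0: "0 \<le> C" by (simp add: C_def)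
  have *: "prod x ({1..n} - {r, s}) = x t * P" if "{r, s, t} = {i, j, k}" "t \<in> {1..n}" "t \<notin> {r, s}" for r s t
  proof -
    have "{1..n} - {r, s} - {t} = {1..n} - {i, j, k}" unfolding that(1)[symmetric] by blast
    then show ?thesis using prod.remove[of "{1..n} - {r, s}" t x] that by (simp add: P_def)
  qed
  have g: "cmod (extension (trunc \<phi>) \<gamma>) = x k * P"
    unfolding h(7) norm_extension_trunc[OF v h(4-6)] x_def[symmetric] by (rule *) (use k in auto)
  have \<alpha>: "cmod (extension (trunc \<phi>) (subtree v {i, k})) = x j * P"
    using norm_extension_trunc[of v i k \<phi>] *[of i k j] v h(4-6) k by (auto simp: x_def[symmetric])
  have \<beta>: "cmod (extension (trunc \<phi>) (subtree v {j, k})) = x i * P"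
    using norm_extension_trunc[of v j k \<phi>] *[of j k i] v h(4-6) k by (auto simp: x_def[symmetric])
  have "x k \<le> C * prod x ({1..n} - {k})"
    using truncated_quadratic_root_bound[of "{1..n}" k "\<lambda>l. \<phi> (subtree v (hat l))" \<mu>] \<phi> v k(1)
    unfolding mu_hurwitz_map_def x_def C_def by (simp add: add_ac)
  also have "prod x ({1..n} - {k}) = x i * (x j * P)"
  proof -
    have "{1..n} - {k} - {i} = {1..n} - {i, k}" by blast
    then show ?thesis using prod.remove[of "{1..n} - {k}" i x] *[of i k j] h(4-6) k by auto
  qed
  \<comment> \<open>The extra factors \<open>C\<close> and \<open>P\<close> supply exactly what is
    needed to regroup the right side into one factor \<open>C * (x j * P)\<close> and one
    \<open>C * (x i * P)\<close>, to which the induction hypotheses apply.\<close>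
  finally have "C * (x k * P) \<le> C * ((C * (x i * (x j * P))) * P)"
    using C0 P0 by (intro mult_left_mono mult_right_mono)
  also have "\<dots> = (C * (x j * P)) * (C * (x i * P))" by (simp add: algebra_simps)
  also have "\<dots> \<le> B ^ a * B ^ b"
    using IH unfolding \<alpha> \<beta>
    by (rule mult_mono) (use C0 P0 IH(1) \<alpha> in \<open>auto simp: x_def intro: order_trans[rotated]\<close>)
  finally show ?case unfolding g by (simp add: power_add)
qed

lemma fib_value_fib:
  assumes "\<gamma> \<in> \<A>"
  shows "fib_value \<gamma> (fib \<gamma>)"
proof -
  obtain m where "fib_value \<gamma> m" using assms fib_value_exists unfolding \<A>_def by blast
  then show ?thesis using fib_eqI by simp
qed

lemma log_plus_extension_bound:
  assumes \<phi>: "mu_hurwitz_map \<mu> \<phi>" and n: "0 < n"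
  shows "upper_fibonacci_bound (\<lambda>\<gamma>. log_plus (cmod (extension \<phi> \<gamma>)))"
proof -
  define C where "C = real n + 1 + cmod \<mu>"
  define R where "R = (\<Prod>l\<in>{1..n}. max 1 (cmod (\<phi> (subtree v\<^sub>0 (hat l)))))"
  \<comment> \<open>Strictness makes the Fibonacci constant \<open>ln (C * R)\<close>
    positive.\<close>
  have C: "1 < C" using n by (simp add: C_def add_pos_nonneg)
  have "1 \<le> R" unfolding R_def by (rule prod_ge_1) simp
  then have "C * 1 \<le> C * R" using C by (intro mult_left_mono) auto
  then have B: "1 < C * R" using C by linarith
  have "log_plus (cmod (extension \<phi> \<gamma>)) \<le> ln (C * R) * fib \<gamma>" if "\<gamma> \<in> \<A>" for \<gamma>
  proof -
    let ?e = "cmod (extension (trunc \<phi>) \<gamma>)"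
    have "1 * ?e \<le> C * ?e" using C by (intro mult_right_mono) auto
    also have "\<dots> \<le> (C * R) ^ fib \<gamma>"
      using fib_value_bound[OF \<phi> fib_value_fib[OF that]] by (simp add: C_def R_def)
    finally have "log_plus (cmod (extension \<phi> \<gamma>)) \<le> ln ((C * R) ^ fib \<gamma>)"
      using norm_extension_le_trunc[OF that, of \<phi>] B by (intro log_plus_le) (auto intro: one_le_power)
    also have "\<dots> = ln (C * R) * fib \<gamma>" using B by (subst ln_realpow) auto
    finally show ?thesis .
  qed
  \<comment> \<open>The bound holds on all of \<open>\<A>\<close>, so the exceptional set is
    empty.\<close>
  then have "{\<gamma> \<in> \<A>. \<not> log_plus (cmod (extension \<phi> \<gamma>)) \<le> ln (C * R) * fib \<gamma>} = {}" by blast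
  moreover have "0 < ln (C * R)" using B by simp
  ultimately show ?thesis unfolding upper_fibonacci_bound_def by (metis finite.emptyI)
qed

end

theorem proposition3p10:
  fixes n :: nat and V :: "'v set" and E :: "'v set set" and lab :: "'v set \<Rightarrow> nat" and v\<^sub>0 :: 'v
    and \<mu> :: complex and \<phi> :: "'v set \<Rightarrow> complex"
  assumes "labelled_tree n V E lab v\<^sub>0"
    and "3 \<le> n"
    and "labelled_tree.mu_hurwitz_map n V E lab \<mu> \<phi>"
  shows "labelled_tree.upper_fibonacci_bound n V E lab v\<^sub>0
    (\<lambda>\<gamma>. log_plus (cmod (labelled_tree.extension n V E lab \<phi> \<gamma>)))"
  using labelled_tree.log_plus_extension_bound[OF assms(1,3)] assms(2) by simp

end
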